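(* Let $\mathbb{D}=\{z\in\mathbb{C}:|z|<1\}$ and let $\overline{\mathbb{D}}$ be its closure. (a) Let $f$ be meromorphic in $\mathbb{D}$ and such that $f(0)=f'(0)-1=0$. If $$\left|\frac{z}{f(z)}-z\left(\frac{z}{f(z)}\right)'-1\right|<1\quad\text{for all } z\in\mathbb{D},$$ then $f$ (extended to the boundary) is continuous in $\overline{\mathbb{D}}$ with the possible exception of zeros in $\overline{\mathbb{D}}$ of the function $$A(z)=1+cz-z\int_0^z\omega(t)\,dt,$$ where $c\in\mathbb{C}$ and the holomorphic function $\omega$ on $\mathbb{D}$ with $|\omega|\le 1$ are those determined by $z/f(z)=A(z)$ for $z\in\mathbb{D}$. That is, $z\mapsto z/A(z)$ is a continuous complex-valued extension of $f$ to $\{z\in\overline{\mathbb{D}}: A(z)\neq 0\}$. (b) Let $f$ be meromorphic in $\mathbb{D}$ and such that $f(0)=f'(0)-1=0$. If, for some $\lambda\in(0,1)$, $$\left|\frac{z}{f(z)}-z\left(\frac{z}{f(z)}\right)'-1\right|<\lambda\quad\text{for all } z\in\mathbb{D},$$ then $f$ (extended to the boundary) is univalent in $\overline{\mathbb{D}}$.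
   Context: The function $z/f(z)$ is understood as the meromorphic function on $\mathbb{D}$ obtained after removing removable singularities: it takes the value $1$ at $z=0$ and $0$ at poles of $f$; the hypothesis that the inequality holds for all $z\in\mathbb{D}$ includes that $z/f(z)$ is finite (holomorphic) at every point of $\mathbb{D}$. A function $f$, meromorphic in $\mathbb{D}$ with $f(0)=f'(0)-1=0$, satisfies the inequality in (a) if and only if there are a constant $c\in\mathbb{C}$ and a holomorphic function $\omega$ on $\mathbb{D}$ with $|\omega(z)|\le 1$ for all $z\in\mathbb{D}$ such that $\frac{z}{f(z)}=1+cz-z\int_0^z\omega(t)\,dt$ on $\mathbb{D}$; this right-hand side is denoted $A(z)$. In particular this applies to $f$ as in (b). For $|z|=1$, the value $A(z)$ is defined by the same formula, with $\int_0^z\omega(t)\,dt$ taken along the radius from $0$ to $z$ (convergent because $\omega$ is bounded). The extension of $f$ to $\overline{\mathbb{D}}$ is $f(z)=z/A(z)$, with the value $\infty$ at points where $A(z)=0$. Univalent in $\overline{\mathbb{D}}$ means that this extension is injective as a map from $\overline{\mathbb{D}}$ to the Riemann sphere $\mathbb{C}\cup\{\infty\}$. *)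

theory Defs
  imports "HOL-Complex_Analysis.Complex_Analysis"
begin

(* "Meromorphic" is rendered by nicely_meromorphic_on: apart from its poles, where the library
   convention assigns the value 0, f is continuous, so there are no spurious isolated values.
   f is required to be differentiable at 0, which rules out a pole there
   (a pole would also have f 0 = 0 by convention). *)
definition normalized_meromorphic :: "(complex \<Rightarrow> complex) \<Rightarrow> bool" where
  "normalized_meromorphic f \<longleftrightarrow>
     f nicely_meromorphic_on ball 0 1 \<and> f 0 = 0 \<and> (f has_field_derivative 1) (at 0)"

(* z / f(z) with removable singularities removed: value 1 at 0 and 0 at poles of f.
   At a genuine pole (a zero of f other than 0) remove_sings gives 0; such points are excluded
   by the holomorphy condition in U_cond. *)
definition quot :: "(complex \<Rightarrow> complex) \<Rightarrow> complex \<Rightarrow> complex" where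
  "quot f = remove_sings (\<lambda>z. z / f z)"

definition U_cond :: "real \<Rightarrow> (complex \<Rightarrow> complex) \<Rightarrow> bool" where
  "U_cond r f \<longleftrightarrow> quot f holomorphic_on ball 0 1 \<and>
     (\<forall>z\<in>ball 0 1. norm (quot f z - z * deriv (quot f) z - 1) < r)"

(* For norm z = 1 only the values of \<omega> on the open radius matter: the integral ignores the
   endpoint z, where \<omega> is not constrained. The integral exists for bounded holomorphic \<omega>. *)
definition A_fun :: "complex \<Rightarrow> (complex \<Rightarrow> complex) \<Rightarrow> complex \<Rightarrow> complex" where
  "A_fun c \<omega> z = 1 + c * z - z * contour_integral (linepath 0 z) \<omega>"

definition represents ::
  "complex \<Rightarrow> (complex \<Rightarrow> complex) \<Rightarrow> (complex \<Rightarrow> complex) \<Rightarrow> bool" where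
  "represents c \<omega> f \<longleftrightarrow>
     \<omega> holomorphic_on ball 0 1 \<and> (\<forall>z\<in>ball 0 1. norm (\<omega> z) \<le> 1) \<and>
     (\<forall>z\<in>ball 0 1. quot f z = A_fun c \<omega> z)"

(* The Riemann sphere as a set: None is the point at infinity. *)
type_synonym sphere = "complex option"

definition extension :: "complex \<Rightarrow> (complex \<Rightarrow> complex) \<Rightarrow> complex \<Rightarrow> sphere" where
  "extension c \<omega> z = (if A_fun c \<omega> z = 0 then None else Some (z / A_fun c \<omega> z))"

end

theory Submission
  imports Defs
begin

text \<open>
  Write \<open>p = z/f\<close>. Since \<open>p 0 = 1\<close>, there is a holomorphic \<open>h\<close> with \<open>p = 1 + z h\<close>, and then
  \<open>p - z p' - 1 = - z\<^sup>2 h'\<close>. So the hypothesis is a bound on \<open>z\<^sup>2 \<omega>\<close> for \<open>\<omega> = - h'\<close>, and the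
  maximum principle turns it into the same bound on \<open>\<omega>\<close> itself (compare
  \<open>bound_of_square_multiple_bound\<close>). Integrating \<open>h' = - \<omega>\<close> gives the representation
  \<open>p = A\<close> with \<open>c = h 0\<close> (\<open>representation_exists\<close>). Conversely every representation has
  \<open>p - z p' - 1 = z\<^sup>2 \<omega>\<close> (\<open>defect_of_representation\<close>), so a bound \<open>\<lambda>\<close> in the hypothesis is
  inherited by any \<open>\<omega>\<close> that represents \<open>f\<close>.

  A bound \<open>l\<close> on \<open>\<omega>\<close> makes a primitive \<open>g\<close> of \<open>\<omega>\<close> Lipschitz with constant \<open>l\<close>, so \<open>g\<close> extends to
  the closed disc with the same constant, and the radial integral up to a boundary point is still
  a difference of values of \<open>g\<close>. This gives
  \<open>A z = 1 + z (c + g 0 - g z)\<close> on the closed disc (\<open>A_fun_Lipschitz_form\<close>), from which both parts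
  follow. \<open>A\<close> is continuous there, hence so is \<open>z / A z\<close> off the zeros of \<open>A\<close>. For
  injectivity, \<open>A z / z = 1/z + const - g z\<close>: if two nonzero points have the same image, then
  \<open>1/z - 1/w = g z - g w\<close>, but the left side has modulus at least \<open>\<bar>z - w\<bar>\<close> in the
  closed disc, and the right side at most \<open>\<lambda> \<bar>z - w\<bar>\<close> with \<open>\<lambda> < 1\<close>
  (\<open>inj_on_extension\<close>). Comparing reciprocals also treats the value infinity
  on the same footing, since it corresponds to \<open>A z / z = 0\<close>.
\<close>

section \<open>The quotient z/f(z)\<close>

lemma quot_at_zero:
  assumes "normalized_meromorphic f"
  shows "quot f 0 = 1"
proof -
  have "(f has_field_derivative 1) (at 0)" "f 0 = 0"
    using assms by (auto simp: normalized_meromorphic_def)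
  then have "((\<lambda>z. f z / z) \<longlongrightarrow> 1) (at 0)"
    by (simp add: has_field_derivative_iff)
  then have "((\<lambda>z. inverse (f z / z)) \<longlongrightarrow> inverse 1) (at 0)"
    by (rule tendsto_inverse) simp
  then have "((\<lambda>z. z / f z) \<longlongrightarrow> 1) (at 0)"
    by simp
  then show ?thesis
    unfolding quot_def by (rule remove_sings_eqI)
qed

text \<open>
  Where \<open>z/f(z)\<close> has a nonzero finite limit, \<open>f\<close> has a finite limit and therefore no pole. The
  value of \<open>f\<close> is then its limit, so the convention that \<open>f\<close> is \<open>0\<close> at poles does not interfere.
\<close>

lemma nonzero_quot_determines_value:
  assumes f: "normalized_meromorphic f" and z: "z \<in> ball 0 1" and nz: "quot f z \<noteq> 0"
  shows "f z = z / quot f z"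
proof (cases "z = 0")
  case True
  then show ?thesis using f by (simp add: normalized_meromorphic_def)
next
  case False
  obtain a where a: "((\<lambda>u. u / f u) \<longlongrightarrow> a) (at z)"
    using nz unfolding quot_def remove_sings_def by (auto split: if_splits)
  then have qa: "quot f z = a"
    unfolding quot_def by (rule remove_sings_eqI)
  have "((\<lambda>u. u / (u / f u)) \<longlongrightarrow> z / a) (at z)"
    by (rule tendsto_divide[OF tendsto_ident_at a]) (use nz qa in simp)
  moreover have "\<forall>\<^sub>F u in at z. u / (u / f u) = f u"
    using eventually_neq_at_within[of 0 z UNIV] by eventually_elim auto
  ultimately have lim: "(f \<longlongrightarrow> z / a) (at z)"
    by (rule Lim_transform_eventually)
  then have "\<not> is_pole f z"
    unfolding is_pole_def
    using not_tendsto_and_filterlim_at_infinity[of "at z" f] by auto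
  then have "(f \<longlongrightarrow> f z) (at z)"
    using f z unfolding normalized_meromorphic_def nicely_meromorphic_on_def by blast
  with lim qa show ?thesis
    by (metis tendsto_unique at_neq_bot)
qed

section \<open>Bounds and primitives on the unit disc\<close>

text \<open>
  On the circle of radius \<open>r\<close> the hypothesis says \<open>\<bar>\<omega>\<bar> \<le> l / r\<^sup>2\<close>; by the maximum principle
  this holds inside the circle, and \<open>r\<close> tends to \<open>1\<close>.
\<close>

lemma bound_of_square_multiple_bound:
  fixes \<omega> :: "complex \<Rightarrow> complex"
  assumes hol: "\<omega> holomorphic_on ball 0 1"
    and bd: "\<And>z. z \<in> ball 0 1 \<Longrightarrow> norm (z\<^sup>2 * \<omega> z) \<le> l"
    and z: "z \<in> ball 0 1"
  shows "norm (\<omega> z) \<le> l"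
proof -
  have le: "r\<^sup>2 * norm (\<omega> z) \<le> l" if r: "norm z < r" "r < 1" for r
  proof -
    have r0: "0 < r" using r norm_ge_zero[of z] by linarith
    have sub: "cball 0 r \<subseteq> ball (0::complex) 1" using r by auto
    have "norm (\<omega> z) \<le> l / r\<^sup>2"
    proof (rule maximum_modulus_frontier[of \<omega> "cball 0 r"])
      show "\<omega> holomorphic_on interior (cball 0 r)"
        using hol sub by (meson holomorphic_on_subset interior_subset order_trans)
      show "continuous_on (closure (cball 0 r)) \<omega>"
        using continuous_on_subset[OF holomorphic_on_imp_continuous_on[OF hol] sub] by simp
      show "norm (\<omega> u) \<le> l / r\<^sup>2" if "u \<in> frontier (cball 0 r)" for u
      proof -
        have u: "norm u = r" using that by (auto simp: frontier_cball)
        then have "r\<^sup>2 * norm (\<omega> u) \<le> l"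
          using bd[of u] r by (simp add: norm_mult norm_power)
        then show ?thesis using r0 by (simp add: field_simps)
      qed
      show "z \<in> cball 0 r" using r by simp
    qed simp
    then show ?thesis using r0 by (simp add: field_simps)
  qed
  have "((\<lambda>r. r\<^sup>2 * norm (\<omega> z)) \<longlongrightarrow> 1\<^sup>2 * norm (\<omega> z)) (at_left 1)"
    by (intro tendsto_intros)
  moreover have "\<forall>\<^sub>F r in at_left 1. r\<^sup>2 * norm (\<omega> z) \<le> l"
    unfolding eventually_at_left_field using z le by (intro exI[of _ "norm z"]) auto
  ultimately have "1\<^sup>2 * norm (\<omega> z) \<le> l"
    by (rule tendsto_upperbound) simp
  then show ?thesis by simp
qed

text \<open>
  For \<open>\<bar>z\<bar> = 1\<close> the endpoint of the segment leaves the open disc, and \<open>\<omega>\<close> is unconstrained there.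
  The fundamental theorem of calculus only asks for the derivative of \<open>t \<mapsto> g (t z)\<close> at interior
  points of the parameter interval and for continuity at its ends, so the formula survives.
\<close>

lemma radial_integral_eq_primitive:
  fixes g :: "complex \<Rightarrow> complex"
  assumes cont: "continuous_on (cball 0 1) g"
    and der: "\<And>u. u \<in> ball 0 1 \<Longrightarrow> (g has_field_derivative \<omega> u) (at u)"
    and z: "z \<in> cball 0 1"
  shows "contour_integral (linepath 0 z) \<omega> = g z - g 0"
proof (rule contour_integral_unique)
  have "((\<lambda>t. \<omega> (linepath 0 z t) * z) has_integral
          (g (linepath 0 z 1) - g (linepath 0 z 0))) {0..1}"
  proof (rule fundamental_theorem_of_calculus_interior)
    have "linepath 0 z ` {0..1} \<subseteq> cball 0 1"
      using z by (auto simp: linepath_def norm_mult intro!: mult_le_one)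
    then show "continuous_on {0..1} (\<lambda>t. g (linepath 0 z t))"
      by (intro continuous_on_compose2[OF cont] continuous_on_linepath) auto
    show "((\<lambda>t. g (linepath 0 z t)) has_vector_derivative \<omega> (linepath 0 z t) * z) (at t)"
      if t: "t \<in> {0<..<1}" for t
    proof -
      have "norm (linepath 0 z t) \<le> t"
        using t z by (simp add: linepath_def norm_mult mult_left_le)
      also have "t < 1" using t by simp
      finally have "linepath 0 z t \<in> ball 0 1" by simp
      moreover have "(linepath 0 z has_vector_derivative z) (at t)"
        using has_vector_derivative_linepath_within[of 0 z t UNIV] by simp
      ultimately show ?thesis
        using field_vector_diff_chain_at[of "linepath 0 z" z t g "\<omega> (linepath 0 z t)"] der
        by (simp add: o_def mult.commute)
    qed
  qed simp
  then show "(\<omega> has_contour_integral (g z - g 0)) (linepath 0 z)"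
    by (simp add: has_contour_integral_linepath)
qed

text \<open>
  The mean value inequality on the convex open disc makes the primitive Lipschitz with the bound of
  \<open>\<omega>\<close> as constant, and Lipschitz maps into a complete space extend to the closure with the same
  constant.
\<close>

lemma Lipschitz_primitive_on_cball:
  fixes \<omega> :: "complex \<Rightarrow> complex"
  assumes hol: "\<omega> holomorphic_on ball 0 1"
    and bd: "\<And>z. z \<in> ball 0 1 \<Longrightarrow> norm (\<omega> z) \<le> l"
  obtains g where "l-lipschitz_on (cball 0 1) g"
    and "\<And>z. z \<in> ball 0 1 \<Longrightarrow> (g has_field_derivative \<omega> z) (at z)"
proof -
  obtain G where G: "\<And>z. z \<in> ball 0 1 \<Longrightarrow> (G has_field_derivative \<omega> z) (at z)"
    using holomorphic_convex_primitive'[OF convex_ball open_ball hol] by (metis at_within_open open_ball)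
  have l0: "0 \<le> l" using order_trans[OF norm_ge_zero bd[of 0]] by simp
  have "l-lipschitz_on (ball 0 1) G"
  proof (rule lipschitz_onI[OF _ l0])
    fix x y :: complex assume "x \<in> ball 0 1" "y \<in> ball 0 1"
    then show "dist (G x) (G y) \<le> l * dist x y"
      unfolding dist_norm
      by (intro field_differentiable_bound[of "ball 0 1" G \<omega>]) (auto intro!: bd has_field_derivative_at_within[OF G])
  qed
  then obtain g where g: "l-lipschitz_on (closure (ball 0 1)) g"
    and gG: "\<And>x. x \<in> ball 0 1 \<Longrightarrow> g x = G x"
    using lipschitz_extend_closure by blast
  show thesis
  proof
    show "l-lipschitz_on (cball 0 1) g" using g by simp
    show "(g has_field_derivative \<omega> z) (at z)" if "z \<in> ball 0 1" for z
      using has_field_derivative_transform_within_open[OF G[OF that] open_ball that] gG by simp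
  qed
qed

section \<open>The function A on the closed disc\<close>

text \<open>
  The form in which \<open>A\<close> is used below: up to the boundary, all its irregularity sits in a function
  \<open>g\<close> whose Lipschitz constant is the bound of \<open>\<omega>\<close>.
\<close>

lemma A_fun_Lipschitz_form:
  assumes hol: "\<omega> holomorphic_on ball 0 1"
    and bd: "\<And>z. z \<in> ball 0 1 \<Longrightarrow> norm (\<omega> z) \<le> l"
  obtains g where "l-lipschitz_on (cball 0 1) g"
    and "\<And>z. z \<in> ball 0 1 \<Longrightarrow> (g has_field_derivative \<omega> z) (at z)"
    and "\<And>z. z \<in> cball 0 1 \<Longrightarrow> A_fun c \<omega> z = 1 + z * (c + g 0 - g z)"
proof -
  obtain g where g: "l-lipschitz_on (cball 0 1) g"
    and der: "\<And>z. z \<in> ball 0 1 \<Longrightarrow> (g has_field_derivative \<omega> z) (at z)"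
    using Lipschitz_primitive_on_cball[OF hol bd] by blast
  have "A_fun c \<omega> z = 1 + z * (c + g 0 - g z)" if "z \<in> cball 0 1" for z
    unfolding A_fun_def
      radial_integral_eq_primitive[OF lipschitz_on_continuous_on[OF g] der that, simplified]
    by (simp add: algebra_simps)
  with g der show thesis by (rule that)
qed

lemma continuous_on_A_fun:
  assumes "represents c \<omega> f"
  shows "continuous_on (cball 0 1) (A_fun c \<omega>)"
proof -
  obtain g where "1-lipschitz_on (cball 0 1) g"
    and A: "\<And>z. z \<in> cball 0 1 \<Longrightarrow> A_fun c \<omega> z = 1 + z * (c + g 0 - g z)"
    using assms A_fun_Lipschitz_form[of \<omega> 1] unfolding represents_def by metis
  then have "continuous_on (cball 0 1) (\<lambda>z. 1 + z * (c + g 0 - g z))"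
    by (intro continuous_intros lipschitz_on_continuous_on)
  then show ?thesis
    by (rule continuous_on_eq) (simp add: A)
qed

text \<open>
  This transfers the bound assumed for \<open>f\<close> to an arbitrary representing \<open>\<omega>\<close>, which is known a
  priori only to be bounded by \<open>1\<close>.
\<close>

lemma defect_of_representation:
  assumes rep: "represents c \<omega> f" and z: "z \<in> ball 0 1"
  shows "quot f z - z * deriv (quot f) z - 1 = z\<^sup>2 * \<omega> z"
proof -
  have hol: "\<omega> holomorphic_on ball 0 1" and bd: "\<And>z. z \<in> ball 0 1 \<Longrightarrow> norm (\<omega> z) \<le> 1"
    and q: "\<And>z. z \<in> ball 0 1 \<Longrightarrow> quot f z = A_fun c \<omega> z"
    using rep by (auto simp: represents_def)
  obtain g where der: "\<And>z. z \<in> ball 0 1 \<Longrightarrow> (g has_field_derivative \<omega> z) (at z)"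
    and A: "\<And>z. z \<in> cball 0 1 \<Longrightarrow> A_fun c \<omega> z = 1 + z * (c + g 0 - g z)"
    using A_fun_Lipschitz_form[OF hol bd] by metis
  have eq: "quot f u = 1 + u * (c + g 0 - g u)" if "u \<in> ball 0 1" for u
    using q[OF that] A[of u] that by simp
  have "((\<lambda>u. 1 + u * (c + g 0 - g u)) has_field_derivative
          ((c + g 0 - g z) - z * \<omega> z)) (at z)"
    by (rule derivative_eq_intros refl der[OF z] | simp)+
  then have "(quot f has_field_derivative ((c + g 0 - g z) - z * \<omega> z)) (at z)"
    by (rule has_field_derivative_transform_within_open[OF _ open_ball z]) (simp add: eq)
  then have deriv: "deriv (quot f) z = (c + g 0 - g z) - z * \<omega> z"
    by (rule DERIV_imp_deriv)
  show ?thesis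
    unfolding eq[OF z] deriv by (simp add: algebra_simps power2_eq_square)
qed

text \<open>
  The choice \<open>\<omega> = - h'\<close>, where \<open>z/f = 1 + z h\<close>, makes \<open>\<omega>\<close> holomorphic at \<open>0\<close> without dividing
  by \<open>z\<^sup>2\<close>: the double zero of \<open>p - z p' - 1\<close> at \<open>0\<close>, with \<open>p = z/f\<close>, is built into the formula.
\<close>

lemma representation_exists:
  assumes f: "normalized_meromorphic f" and U: "U_cond l f" and l: "l \<le> 1"
  shows "\<exists>c \<omega>. represents c \<omega> f"
proof -
  let ?p = "quot f"
  define h where "h = (\<lambda>z. if z = 0 then deriv ?p 0 else (?p z - ?p 0) / (z - 0))"
  have hol: "?p holomorphic_on ball 0 1" using U by (simp add: U_cond_def)
  have h: "h holomorphic_on ball 0 1"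
    unfolding h_def by (rule pole_lemma[OF hol]) simp
  have p: "?p z = 1 + z * h z" for z
    using quot_at_zero[OF f] by (simp add: h_def)
  define \<omega> where "\<omega> = (\<lambda>z. - deriv h z)"
  have hder: "(h has_field_derivative deriv h z) (at z)" if "z \<in> ball 0 1" for z
    using h that by (intro holomorphic_derivI[of h "ball 0 1"]) auto
  have \<omega>: "\<omega> holomorphic_on ball 0 1"
    unfolding \<omega>_def using h by (intro holomorphic_intros) auto
  have defect: "?p z - z * deriv ?p z - 1 = z\<^sup>2 * \<omega> z" if z: "z \<in> ball 0 1" for z
  proof -
    have "((\<lambda>u. 1 + u * h u) has_field_derivative h z + z * deriv h z) (at z)"
      by (rule derivative_eq_intros refl hder[OF z] | simp)+
    then have "deriv ?p z = h z + z * deriv h z"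
      using p by (intro DERIV_imp_deriv) presburger
    then show ?thesis
      by (simp add: p[of z] \<omega>_def algebra_simps power2_eq_square)
  qed
  have bd: "norm (\<omega> z) \<le> 1" if "z \<in> ball 0 1" for z
  proof (rule bound_of_square_multiple_bound[OF \<omega> _ that])
    fix u :: complex assume u: "u \<in> ball 0 1"
    then have "norm (?p u - u * deriv ?p u - 1) < l" using U by (simp add: U_cond_def)
    then show "norm (u\<^sup>2 * \<omega> u) \<le> 1" using defect[OF u] l by simp
  qed
  have "?p z = A_fun (h 0) \<omega> z" if z: "z \<in> ball 0 1" for z
  proof -
    have "contour_integral (linepath 0 z) \<omega> = (- h z) - (- h 0)"
    proof (rule contour_integral_unique)
      have "(\<omega> has_contour_integral (- h (pathfinish (linepath 0 z)) - - h (pathstart (linepath 0 z))))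
              (linepath 0 z)"
      proof (rule contour_integral_primitive[where S = "ball 0 1"])
        show "((\<lambda>u. - h u) has_field_derivative \<omega> u) (at u within ball 0 1)"
          if "u \<in> ball 0 1" for u
          unfolding \<omega>_def by (intro DERIV_minus DERIV_subset[OF hder[OF that]]) simp
        show "path_image (linepath 0 z) \<subseteq> ball 0 1"
          using z by (simp add: closed_segment_subset)
      qed (rule valid_path_linepath)
      then show "(\<omega> has_contour_integral (- h z) - (- h 0)) (linepath 0 z)" by simp
    qed
    then show ?thesis by (simp add: A_fun_def p[of z] right_diff_distrib)
  qed
  with \<omega> bd show ?thesis unfolding represents_def by blast
qed

section \<open>Injectivity of the extension\<close>

text \<open>
  Equal images of nonzero points mean \<open>1/z - 1/w = g z - g w\<close>, and \<open>z \<mapsto> 1/z\<close> does not contract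
  distances in the closed disc while \<open>g\<close> contracts them strictly.
\<close>

lemma inj_on_extension:
  assumes hol: "\<omega> holomorphic_on ball 0 1"
    and bd: "\<And>z. z \<in> ball 0 1 \<Longrightarrow> norm (\<omega> z) \<le> l"
    and l: "l < 1"
  shows "inj_on (extension c \<omega>) (cball 0 1)"
proof (rule inj_onI, rule ccontr)
  fix z w :: complex
  assume z: "z \<in> cball 0 1" and w: "w \<in> cball 0 1"
    and eq: "extension c \<omega> z = extension c \<omega> w" and ne: "z \<noteq> w"
  obtain g where g: "l-lipschitz_on (cball 0 1) g"
    and A: "\<And>z. z \<in> cball 0 1 \<Longrightarrow> A_fun c \<omega> z = 1 + z * (c + g 0 - g z)"
    using A_fun_Lipschitz_form[OF hol bd] by blast
  \<comment> \<open>\<open>A 0 = 1\<close>, so \<open>0\<close> is the only point with image \<open>0\<close>.\<close>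
  have nz: "z \<noteq> 0" "w \<noteq> 0"
    using eq ne A[OF z] A[OF w] by (auto simp: extension_def split: if_splits)
  \<comment> \<open>If both images are infinity, both sides are \<open>0\<close>.\<close>
  have "A_fun c \<omega> z / z = A_fun c \<omega> w / w"
    using eq nz by (auto simp: extension_def field_simps split: if_splits)
  then have "w - z = z * w * (g z - g w)"
    using nz unfolding A[OF z] A[OF w] by (simp add: field_simps)
  then have "norm (w - z) = norm z * norm w * norm (g z - g w)"
    by (simp add: norm_mult)
  also have "\<dots> \<le> 1 * norm (g z - g w)"
    using z w by (intro mult_right_mono mult_le_one) auto
  also have "\<dots> \<le> l * norm (w - z)"
    using lipschitz_onD[OF g z w] by (simp add: dist_norm norm_minus_commute)
  finally have "(1 - l) * norm (w - z) \<le> 0" by (simp add: algebra_simps)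
  then show False using l ne by (simp add: mult_le_0_iff)
qed

section \<open>Continuity and univalence on the closed disc\<close>

theorem theorem2:
  fixes f :: "complex \<Rightarrow> complex"
  assumes "normalized_meromorphic f"
  shows "(U_cond 1 f \<longrightarrow>
            (\<exists>c \<omega>. represents c \<omega> f) \<and>
            (\<forall>c \<omega>. represents c \<omega> f \<longrightarrow>
               continuous_on {z \<in> cball 0 1. A_fun c \<omega> z \<noteq> 0} (\<lambda>z. z / A_fun c \<omega> z) \<and>
               (\<forall>z\<in>ball 0 1. A_fun c \<omega> z \<noteq> 0 \<longrightarrow> f z = z / A_fun c \<omega> z)))
       \<and> ((\<exists>l\<in>{0<..<1}. U_cond l f) \<longrightarrow>
            (\<exists>c \<omega>. represents c \<omega> f) \<and>
            (\<forall>c \<omega>. represents c \<omega> f \<longrightarrow> inj_on (extension c \<omega>) (cball 0 1)))"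
proof (intro conjI impI allI)
  assume "U_cond 1 f"
  then show "\<exists>c \<omega>. represents c \<omega> f"
    by (rule representation_exists[OF assms]) simp
next
  fix c \<omega> assume rep: "represents c \<omega> f"
  show "continuous_on {z \<in> cball 0 1. A_fun c \<omega> z \<noteq> 0} (\<lambda>z. z / A_fun c \<omega> z)"
    by (intro continuous_intros continuous_on_subset[OF continuous_on_A_fun[OF rep]]) auto
  show "\<forall>z\<in>ball 0 1. A_fun c \<omega> z \<noteq> 0 \<longrightarrow> f z = z / A_fun c \<omega> z"
    using nonzero_quot_determines_value[OF assms] rep by (metis represents_def)
next
  assume "\<exists>l\<in>{0<..<1}. U_cond l f"
  then show "\<exists>c \<omega>. represents c \<omega> f"
    using representation_exists[OF assms] by (metis greaterThanLessThan_iff less_imp_le)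
next
  fix c \<omega> assume rep: "represents c \<omega> f" and "\<exists>l\<in>{0<..<1}. U_cond l f"
  then obtain l where l: "l < 1" and U: "U_cond l f" by auto
  have hol: "\<omega> holomorphic_on ball 0 1" using rep by (simp add: represents_def)
  have "norm (u\<^sup>2 * \<omega> u) \<le> l" if "u \<in> ball 0 1" for u
    using U that defect_of_representation[OF rep that] unfolding U_cond_def
    by (metis less_imp_le)
  then show "inj_on (extension c \<omega>) (cball 0 1)"
    using inj_on_extension[OF hol bound_of_square_multiple_bound[OF hol] l] by blast
qed

end
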